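(* Let $k$ be a positive integer and let $c(n,k)$ be defined by $(1-k^2x)^{-1/k}=\sum_{n\ge 0}c(n,k)x^n$. Let $p$ be a prime of the form $p=ku+1$ with $u$ an integer. Then for $n\ge 0$, $p$ does not divide $c(n,k)$ if and only if every digit of $n$ in base $p$ is less than $p/k$. *)

theory Defs
  imports
    "HOL-Computational_Algebra.Formal_Power_Series"
    "HOL-Computational_Algebra.Primes"
begin

(* fps_binomial a is the binomial series (1 + X)^a, so substituting -k^2 X with a = -1/k
   gives (1 - k^2 x)^(-1/k). *)
definition gen_series :: "nat \<Rightarrow> rat fps" where
  "gen_series k =
     fps_binomial (- 1 / of_nat k) oo (fps_const (- (of_nat k ^ 2)) * fps_X)"

definition c :: "nat \<Rightarrow> nat \<Rightarrow> rat" where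
  "c n k = fps_nth (gen_series k) n"

lemma gen_series_power:
  assumes "k > 0"
  shows "gen_series k ^ k * (1 - fps_const (of_nat k ^ 2) * fps_X) = 1"
    and "fps_nth (gen_series k) 0 = 1"
proof -
  let ?y = "fps_const (- (of_nat k ^ 2)) * fps_X :: rat fps"
  have "gen_series k ^ k = fps_binomial (- 1) oo ?y"
    using assms by (simp add: gen_series_def fps_compose_power fps_binomial_power)
  moreover have "1 - fps_const (of_nat k ^ 2) * fps_X = fps_binomial 1 oo ?y"
    by (simp add: fps_binomial_1 fps_compose_add_distrib flip: fps_const_neg)
  ultimately have "gen_series k ^ k * (1 - fps_const (of_nat k ^ 2) * fps_X)
      = (fps_binomial (- 1) oo ?y) * (fps_binomial 1 oo ?y)"
    by simp
  also have "\<dots> = (fps_binomial (- 1) * fps_binomial 1) oo ?y"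
    by (rule fps_compose_mult_distrib [symmetric]) simp
  also have "\<dots> = 1"
    by (simp flip: fps_binomial_add_mult)
  finally show "gen_series k ^ k * (1 - fps_const (of_nat k ^ 2) * fps_X) = 1" .
  show "fps_nth (gen_series k) 0 = 1"
    by (simp add: gen_series_def)
qed

definition base_digit :: "nat \<Rightarrow> nat \<Rightarrow> nat \<Rightarrow> nat" where
  "base_digit b n i = n div b ^ i mod b"

end

theory Submission
  imports Defs "HOL-Number_Theory.Residues"
begin

text \<open>
  Write \<open>f = (1 - k\<^sup>2 x)\<^sup>-\<^sup>1\<^sup>/\<^sup>k\<close>. Substituting \<open>f = 1 + k g\<close> into \<open>f\<^sup>k (1 - k\<^sup>2 x) = 1\<close> and dividing by
  \<open>k\<^sup>2\<close> gives an equation with integer coefficients that determines the coefficients of \<open>g\<close>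
  recursively, so \<open>f\<close> is integral. Since \<open>f\<^sup>p = f (f\<^sup>k)\<^sup>u\<close>, we have
  \<open>f = f\<^sup>p (1 - k\<^sup>2 x)\<^sup>u\<close>, which is congruent to \<open>f(x\<^sup>p) (1 - k\<^sup>2 x)\<^sup>u\<close> modulo \<open>p\<close>. As \<open>u < p\<close>, this
  reads \<open>c(pm + r) \<equiv> c(m) (u choose r) (-k\<^sup>2)\<^sup>r\<close> for \<open>r < p\<close>, and the last two factors are
  nonzero modulo \<open>p\<close> exactly for \<open>r \<le> u\<close>, that is, for \<open>r < p/k\<close>.
\<close>

section \<open>Integrality of the coefficients\<close>

lemma fps_power_nth_Ints:
  fixes G :: "'a::comm_ring_1 fps"
  assumes "\<And>i. i < n \<Longrightarrow> fps_nth G i \<in> \<int>" and "m < n"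
  shows "fps_nth (G ^ j) m \<in> \<int>"
  using assms(2)
proof (induction j arbitrary: m)
  case (Suc j)
  then show ?case
    by (auto simp: fps_mult_nth intro!: Ints_sum Ints_mult assms(1))
qed auto

text \<open>In the convolution of \<open>G\<close> with \<open>G ^ Suc j\<close>, the top
  coefficient of either factor meets the zero constant term of the other. So coefficient
  \<open>n\<close> involves only earlier coefficients of \<open>G\<close>, which makes the recursion
  for \<open>G\<close> well-founded.\<close>

lemma fps_power_nth_Ints_lower:
  fixes G :: "'a::comm_ring_1 fps"
  assumes int: "\<And>i. i < n \<Longrightarrow> fps_nth G i \<in> \<int>" and zero: "fps_nth G 0 = 0"
  shows "fps_nth (G ^ Suc (Suc j)) n \<in> \<int>"
proof -
  have "fps_nth G i * fps_nth (G ^ Suc j) (n - i) \<in> \<int>" if "i \<le> n" for i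
  proof -
    from that consider "i = 0" | "i = n" | "0 < i" "i < n"
      by linarith
    then show ?thesis
    proof cases
      case 3
      then show ?thesis
        by (intro Ints_mult int fps_power_nth_Ints[where n = n]) auto
    qed (auto simp: zero)
  qed
  then show ?thesis
    unfolding power_Suc[of G "Suc j"] fps_mult_nth by (intro Ints_sum) simp
qed

text \<open>In the binomial expansion of \<open>(1 + k G) ^ k\<close> the linear term is
  \<open>k^2 G\<close> and every later term carries a factor \<open>k^2\<close>. The difference of 1
  and the linear factor is \<open>k^2 X\<close>, so \<open>k^2\<close> cancels throughout and
  \<open>G\<close> can be isolated without introducing denominators.\<close>

lemma root_expansion:
  fixes G :: "rat fps"
  assumes "k > 0"
    and eq: "(1 + of_nat k * G) ^ k * (1 - fps_const (of_nat k ^ 2) * fps_X) = 1"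
  shows "G = fps_X * inverse (1 - fps_const (of_nat k ^ 2) * fps_X)
    - (\<Sum>j=2..k. of_nat (k choose j) * of_nat k ^ (j - 2) * G ^ j)"
proof -
  let ?D = "1 - fps_const (of_nat k ^ 2) * fps_X :: rat fps"
  let ?S = "\<Sum>j=2..k. of_nat (k choose j) * of_nat k ^ (j - 2) * G ^ j"
  have D: "?D * inverse ?D = 1"
    by (simp add: inverse_mult_eq_1')
  have const: "fps_const (of_nat k ^ 2) = (of_nat k ^ 2 :: rat fps)"
    by (simp add: fps_of_nat flip: fps_const_power)
  have "(1 + of_nat k * G) ^ k
      = (\<Sum>j\<le>k. of_nat (k choose j) * (of_nat k * G) ^ j)"
    by (subst add.commute, subst binomial_ring) simp
  also have "\<dots> = (\<Sum>j\<in>{0, 1} \<union> {2..k}. of_nat (k choose j) * (of_nat k * G) ^ j)"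
    using \<open>k > 0\<close> by (intro sum.cong) auto
  also have "\<dots> = 1 + of_nat k ^ 2 * G
      + (\<Sum>j=2..k. of_nat (k choose j) * (of_nat k * G) ^ j)"
    by (subst sum.union_disjoint) (auto simp: power2_eq_square algebra_simps)
  also have "(\<Sum>j=2..k. of_nat (k choose j) * (of_nat k * G) ^ j) = of_nat k ^ 2 * ?S"
    unfolding sum_distrib_left
  proof (rule sum.cong)
    fix j assume "j \<in> {2..k}"
    then have "2 + (j - 2) = j"
      by (intro le_add_diff_inverse) simp
    then have "of_nat k ^ j = (of_nat k ^ 2 * of_nat k ^ (j - 2) :: rat fps)"
      by (metis power_add)
    then show "of_nat (k choose j) * (of_nat k * G) ^ j
        = of_nat k ^ 2 * (of_nat (k choose j) * of_nat k ^ (j - 2) * G ^ j)"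
      by (simp add: power_mult_distrib algebra_simps)
  qed simp
  finally have "(1 + of_nat k ^ 2 * (G + ?S)) * ?D = 1"
    using eq by (simp only: distrib_left add.assoc)
  then have "?D + of_nat k ^ 2 * ((G + ?S) * ?D) = 1"
    by (simp only: distrib_right mult_1_left mult.assoc)
  then have "of_nat k ^ 2 * ((G + ?S) * ?D) = 1 - ?D"
    unfolding eq_diff_eq by (subst add.commute)
  also have "1 - ?D = of_nat k ^ 2 * fps_X"
    unfolding const by simp
  finally have "(G + ?S) * ?D = fps_X"
    using \<open>k > 0\<close> by (subst (asm) mult_left_cancel) simp_all
  then have "fps_X * inverse ?D = (G + ?S) * (?D * inverse ?D)"
    by (simp only: mult.assoc[symmetric])
  also have "\<dots> = G + ?S"
    by (simp only: D mult_1_right)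
  finally show ?thesis
    by (simp only: add_diff_cancel_right')
qed

lemma gen_series_Ints:
  assumes "k > 0"
  shows "fps_nth (gen_series k) n \<in> \<int>"
proof -
  \<comment> \<open>Integrality is proved for \<open>G\<close>, which is stronger than for the
    series itself: the recursion needs the factor \<open>k\<close> already divided out.\<close>
  define G where "G = fps_const (1 / of_nat k) * (gen_series k - 1)"
  let ?D = "1 - fps_const (of_nat k ^ 2) * fps_X :: rat fps"
  have f: "gen_series k = 1 + of_nat k * G"
  proof -
    have "of_nat k * fps_const (1 / of_nat k) = (1 :: rat fps)"
      using assms by (simp flip: fps_of_nat)
    then show ?thesis
      by (simp add: G_def flip: mult.assoc)
  qed
  have G0: "fps_nth G 0 = 0"
    using gen_series_power(2)[OF assms] by (simp add: G_def)
  \<comment> \<open>The geometric series shows that the inverse has integer coefficients.\<close>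
  have geom: "inverse ?D = Abs_fps (\<lambda>n. (of_nat k ^ 2) ^ n)"
  proof (rule fps_inverse_unique, rule fps_ext)
    fix n
    show "fps_nth (?D * Abs_fps (\<lambda>n. (of_nat k ^ 2) ^ n)) n = fps_nth 1 n"
      by (cases n) (simp_all add: left_diff_distrib mult.assoc)
  qed
  have expansion: "G = fps_X * inverse ?D
      - (\<Sum>j=2..k. of_nat (k choose j) * of_nat k ^ (j - 2) * G ^ j)"
    using root_expansion[OF assms] gen_series_power(1)[OF assms] unfolding f .
  have "fps_nth G m \<in> \<int>" for m
  proof (induction m rule: less_induct)
    case (less m)
    have "fps_nth (of_nat (k choose j) * of_nat k ^ (j - 2) * G ^ j) m \<in> \<int>"
      if "2 \<le> j" for j
    proof -
      from that obtain i where "j = Suc (Suc i)"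
        by (auto simp: numeral_2_eq_2 Suc_le_eq elim!: less_natE)
      then have "fps_nth (G ^ j) m \<in> \<int>"
        using fps_power_nth_Ints_lower[OF less G0] by simp
      moreover have "of_nat (k choose j) * of_nat k ^ (j - 2)
          = fps_const (of_nat ((k choose j) * k ^ (j - 2)) :: rat)"
        by (simp only: of_nat_mult of_nat_power flip: fps_of_nat fps_const_mult fps_const_power)
      ultimately show ?thesis
        by (simp del: of_nat_mult of_nat_power)
    qed
    then have "fps_nth (\<Sum>j=2..k. of_nat (k choose j) * of_nat k ^ (j - 2) * G ^ j) m \<in> \<int>"
      by (auto simp: fps_sum_nth intro!: Ints_sum)
    moreover have "fps_nth (fps_X * inverse ?D) m \<in> \<int>"
      unfolding geom by simp
    ultimately show ?case
      by (subst expansion) (auto simp only: fps_sub_nth intro!: Ints_diff)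
  qed
  then show ?thesis
    unfolding f by (auto simp: simp flip: fps_of_nat)
qed

text \<open>Congruences modulo \<open>p\<close> need a series over the integers. The functional
  equation descends from the rationals because the coefficientwise embedding \<open>h\<close> is
  multiplicative and injective.\<close>

lemma integral_root_exists:
  assumes "k > 0"
  obtains F :: "int fps" where
    "\<And>n. c n k = of_int (fps_nth F n)"
    "F ^ k * (1 - fps_const (int k ^ 2) * fps_X) = 1"
    "fps_nth F 0 = 1"
proof -
  \<comment> \<open>The floor only changes the type, since each \<open>c n k\<close> is an
    integer.\<close>
  define F where "F = Abs_fps (\<lambda>n. \<lfloor>c n k\<rfloor>)"
  define h :: "int fps \<Rightarrow> rat fps" where "h A = Abs_fps (\<lambda>n. of_int (fps_nth A n))" for A
  have nth: "c n k = of_int (fps_nth F n)" for n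
    using gen_series_Ints[OF assms, of n] by (auto simp: F_def c_def elim: Ints_cases)
  have h_mult: "h (A * B) = h A * h B" for A B
    by (simp add: fps_eq_iff h_def fps_mult_nth)
  have h_1: "h 1 = 1"
    by (simp add: fps_eq_iff h_def)
  have h_power: "h (A ^ n) = h A ^ n" for A n
    by (induction n) (simp_all add: h_1 h_mult)
  have h_inject: "A = B" if "h A = h B" for A B
    using that by (simp add: fps_eq_iff h_def)
  have hF: "h F = gen_series k"
    by (simp add: fps_eq_iff h_def nth c_def flip: nth)
  have hD: "h (1 - fps_const (int k ^ 2) * fps_X) = 1 - fps_const (of_nat k ^ 2) * fps_X"
    by (simp add: fps_eq_iff h_def fps_X_def)
  have "h (F ^ k * (1 - fps_const (int k ^ 2) * fps_X)) = h 1"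
    using gen_series_power(1)[OF assms] by (simp only: h_mult h_power hF hD h_1)
  then have "F ^ k * (1 - fps_const (int k ^ 2) * fps_X) = 1"
    by (rule h_inject)
  moreover have "fps_nth F 0 = 1"
    using gen_series_power(2)[OF assms] nth[of 0] by (simp add: c_def)
  ultimately show ?thesis
    using that nth by blast
qed

section \<open>Prime powers of integer power series modulo \<open>p\<close>\<close>

lemma prime_dvd_binomial_power:
  fixes a b :: "'a::comm_ring_1"
  assumes "prime p"
  shows "of_nat p dvd (a + b) ^ p - (a ^ p + b ^ p)"
proof -
  have p: "p > 0"
    using assms prime_gt_0_nat by blast
  have "(a + b) ^ p = (\<Sum>i\<in>{0, p} \<union> {1..<p}. of_nat (p choose i) * a ^ i * b ^ (p - i))"
    unfolding binomial_ring by (intro sum.cong) auto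
  also have "\<dots> = a ^ p + b ^ p + (\<Sum>i=1..<p. of_nat (p choose i) * a ^ i * b ^ (p - i))"
    using p by (subst sum.union_disjoint) auto
  finally have "(a + b) ^ p - (a ^ p + b ^ p)
      = (\<Sum>i=1..<p. of_nat (p choose i) * a ^ i * b ^ (p - i))"
    by simp
  also have "of_nat p dvd \<dots>"
  proof (intro dvd_sum dvd_mult2)
    fix i assume "i \<in> {1..<p}"
    then have "p dvd p choose i"
      using assms by (intro dvd_choose_prime) auto
    then show "(of_nat p :: 'a) dvd of_nat (p choose i)"
      by (auto elim: dvdE)
  qed
  finally show ?thesis .
qed

lemma fermat_int:
  fixes a :: int
  assumes "prime p"
  shows "[a ^ p = a] (mod int p)"
proof -
  define b where "b = nat (a mod int p)"
  have p: "p > 0"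
    using assms prime_gt_0_nat by blast
  have b: "[a = int b] (mod int p)"
    using p by (simp add: b_def)
  have "[b ^ p = b] (mod p)"
  proof (cases "p dvd b")
    case True
    then have "p dvd b ^ p"
      using p by (simp add: dvd_power_le[of p b 1 p, simplified])
    with True have "b ^ p mod p = 0" "b mod p = 0"
      by (simp_all only: dvd_eq_mod_eq_0)
    then show ?thesis
      by (simp only: cong_def)
  next
    case False
    then have "[b * b ^ (p - 1) = b * 1] (mod p)"
      using fermat_theorem[OF assms] by (intro cong_mult) auto
    then show ?thesis
      using power_minus_mult[OF p, of b] by (simp only: mult.commute[of b] mult_1)
  qed
  then have "[int b ^ p = int b] (mod int p)"
    by (simp add: flip: cong_int_iff)
  then show ?thesis
    using b by (meson cong_pow cong_sym cong_trans)
qed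

text \<open>This is \<open>F(X)^p \<equiv> F(X^p)\<close> coefficientwise. Writing
  \<open>F = a + X G\<close> gives \<open>F^p \<equiv> a^p + X^p G^p\<close>, so a coefficient at
  \<open>n \<ge> p\<close> reduces to the one of \<open>G^p\<close> at \<open>n - p\<close>; the
  induction therefore varies \<open>F\<close>.\<close>

lemma fps_power_prime_nth_cong:
  fixes F :: "int fps"
  assumes "prime p"
  shows "[fps_nth (F ^ p) n = (if p dvd n then fps_nth F (n div p) else 0)] (mod int p)"
proof (induction n arbitrary: F rule: less_induct)
  case (less n)
  have p: "p > 0"
    using assms prime_gt_0_nat by blast
  let ?a = "fps_nth F 0" and ?G = "fps_shift 1 F"
  have "F = fps_const ?a + fps_X * ?G"
    by (auto simp: fps_eq_iff)
  then have "of_nat p dvd F ^ p - (fps_const ?a ^ p + (fps_X * ?G) ^ p)"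
    using prime_dvd_binomial_power[OF assms] by metis
  then obtain H where "F ^ p - (fps_const ?a ^ p + (fps_X * ?G) ^ p) = of_nat p * H"
    by (elim dvdE)
  then have "fps_nth (F ^ p - (fps_const (?a ^ p) + fps_X ^ p * ?G ^ p)) n = int p * fps_nth H n"
    by (simp add: power_mult_distrib flip: fps_of_nat)
  then have "int p dvd fps_nth (F ^ p) n - fps_nth (fps_const (?a ^ p) + fps_X ^ p * ?G ^ p) n"
    by simp
  then have step: "[fps_nth (F ^ p) n
      = fps_nth (fps_const (?a ^ p) + fps_X ^ p * ?G ^ p) n] (mod int p)"
    by (simp add: cong_iff_dvd_diff)
  consider "n = 0" | "0 < n" "n < p" | "p \<le> n"
    by linarith
  then show ?case
  proof cases
    case 1
    then show ?thesis
      using step fermat_int[OF assms, of ?a] p by (auto simp: fps_X_power_mult_nth intro: cong_trans)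
  next
    case 2
    then show ?thesis
      using step by (auto simp: fps_X_power_mult_nth dest: dvd_imp_le)
  next
    case 3
    \<comment> \<open>The shift in \<open>?G\<close> raises the index by one, which compensates for
      \<open>(n - p) div p\<close> being one less than \<open>n div p\<close>.\<close>
    have "[fps_nth (?G ^ p) (n - p)
        = (if p dvd n - p then fps_nth ?G ((n - p) div p) else 0)] (mod int p)"
      using 3 p by (intro less) auto
    moreover have "p dvd n - p \<longleftrightarrow> p dvd n"
      using 3 by (metis dvd_minus_self not_le)
    moreover have "(n - p) div p + 1 = n div p"
      using 3 p by (metis le_div_geq Suc_eq_plus1 not_le)
    ultimately show ?thesis
      using step 3 p by (auto simp: fps_X_power_mult_nth intro: cong_trans)
  qed
qed

section \<open>The coefficient recursion modulo \<open>p\<close>\<close>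

lemma linear_fps_power_nth:
  fixes a :: "'a::comm_ring_1"
  shows "fps_nth ((1 - fps_const a * fps_X) ^ u) r = of_nat (u choose r) * (- a) ^ r"
proof -
  have "(1 - fps_const a * fps_X) ^ u = (fps_const (- a) * fps_X + 1) ^ u"
    by (simp flip: fps_const_neg)
  also have "\<dots> = (\<Sum>i\<le>u. fps_const (of_nat (u choose i) * (- a) ^ i) * fps_X ^ i)"
    unfolding binomial_ring
    by (intro sum.cong)
      (simp_all only: power_mult_distrib fps_const_power power_one mult_1_right
        mult.assoc fps_const_mult[symmetric] fps_of_nat)
  finally show ?thesis
    by (auto simp: fps_sum_nth fps_X_power_nth if_distrib not_le binomial_eq_0 cong: if_cong)
qed

lemma root_coefficient_cong:
  fixes F :: "int fps"
  assumes "prime p" and p: "p = k * u + 1" and "k > 0"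
    and F: "F ^ k * (1 - fps_const a * fps_X) = 1"
  shows "[fps_nth F n
    = fps_nth F (n div p) * (int (u choose (n mod p)) * (- a) ^ (n mod p))] (mod int p)"
proof -
  let ?B = "(1 - fps_const a * fps_X) ^ u"
  let ?E = "\<lambda>i. if p dvd i then fps_nth F (i div p) else 0"
  have "u < p"
    using p \<open>k > 0\<close> by (simp add: le_imp_less_Suc)
  \<comment> \<open>The exponent splits as \<open>p = k u + 1\<close>, leaving one factor
    \<open>F\<close> beside a power of 1.\<close>
  have "F ^ p * ?B = F * (F ^ k * (1 - fps_const a * fps_X)) ^ u"
    by (simp add: p power_mult power_mult_distrib)
  then have "fps_nth F n = fps_nth (F ^ p * ?B) n"
    by (simp add: F)
  also have "\<dots> = (\<Sum>i=0..n. fps_nth (F ^ p) i * fps_nth ?B (n - i))"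
    by (rule fps_mult_nth)
  also have "[\<dots> = (\<Sum>i=0..n. ?E i * fps_nth ?B (n - i))] (mod int p)"
    by (intro cong_sum cong_mult fps_power_prime_nth_cong assms(1) cong_refl)
  also have "(\<Sum>i=0..n. ?E i * fps_nth ?B (n - i))
      = (\<Sum>i\<in>{n div p * p}. ?E i * fps_nth ?B (n - i))"
  \<comment> \<open>\<open>?E\<close> vanishes off the multiples of \<open>p\<close>. A multiple
    \<open>i \<le> n\<close> other than the largest has \<open>n - i \<ge> p > u\<close>, beyond the
    degree of \<open>?B\<close>.\<close>
  proof (rule sum.mono_neutral_right)
    show "\<forall>i\<in>{0..n} - {n div p * p}. ?E i * fps_nth ?B (n - i) = 0"
    proof
      fix i assume i: "i \<in> {0..n} - {n div p * p}"
      have "u < n - i" if "p dvd i"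
      proof (rule ccontr)
        assume "\<not> u < n - i"
        then have "n - i < p"
          using \<open>u < p\<close> by simp
        moreover from that obtain m where "i = p * m"
          by (elim dvdE)
        ultimately have "n = p * m + (n - i)" and "n - i < p"
          using i by auto
        then have "n div p = m"
          by (metis div_mult_self4 div_less add_0_right less_nat_zero_code neq0_conv)
        then show False
          using i \<open>i = p * m\<close> by (simp add: mult.commute)
      qed
      then show "?E i * fps_nth ?B (n - i) = 0"
        by (simp add: linear_fps_power_nth binomial_eq_0)
    qed
  qed auto
  also have "\<dots> = fps_nth F (n div p) * fps_nth ?B (n mod p)"
    using \<open>u < p\<close> by (simp add: minus_div_mult_eq_mod)
  finally show ?thesis
    by (simp add: linear_fps_power_nth)
qed

section \<open>From the recursion to the digit criterion\<close>

lemma all_base_digit_iff: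
  "(\<forall>i. P (base_digit b n i)) \<longleftrightarrow> P (n mod b) \<and> (\<forall>i. P (base_digit b (n div b) i))"
proof -
  have "base_digit b n (Suc i) = base_digit b (n div b) i" for i
    by (simp add: base_digit_def div_mult2_eq)
  moreover have "base_digit b n 0 = n mod b"
    by (simp add: base_digit_def)
  moreover have "(\<forall>i. Q i) \<longleftrightarrow> Q 0 \<and> (\<forall>i. Q (Suc i))" for Q :: "nat \<Rightarrow> bool"
    by (metis not0_implies_Suc)
  note this[of "\<lambda>i. P (base_digit b n i)"]
  ultimately show ?thesis
    by simp
qed

text \<open>Each use of the congruence strips the lowest digit \<open>r\<close> of \<open>n\<close>.
  Powers of \<open>- a\<close> are units modulo \<open>p\<close>, so only the binomial coefficient
  decides whether \<open>r\<close> is allowed.\<close>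

lemma not_dvd_root_coefficient_iff:
  fixes F :: "int fps"
  assumes "prime p" and p: "p = k * u + 1" and "k > 0"
    and F: "F ^ k * (1 - fps_const a * fps_X) = 1" "fps_nth F 0 = 1"
    and a: "\<not> int p dvd a"
  shows "\<not> int p dvd fps_nth F n \<longleftrightarrow> (\<forall>i. base_digit p n i \<le> u)"
proof (induction n rule: less_induct)
  case (less n)
  have prime: "prime (int p)"
    using assms(1) by simp
  have "u < p"
    using p \<open>k > 0\<close> by (simp add: le_imp_less_Suc)
  show ?case
  proof (cases "n = 0")
    case True
    then show ?thesis
      using assms(1) by (auto simp: F base_digit_def)
  next
    case False
    \<comment> \<open>For \<open>r \<le> u\<close> the coefficient divides \<open>fact u\<close>,
      which is prime to \<open>p\<close> because \<open>u < p\<close>; otherwise it is 0.\<close>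
    have choose: "int p dvd int (u choose r) \<longleftrightarrow> \<not> r \<le> u" for r
    proof (cases "r \<le> u")
      case True
      then have "u choose r dvd fact u"
        by (metis binomial_fact_lemma dvd_triv_right)
      moreover have "\<not> p dvd fact u"
        using assms(1) \<open>u < p\<close> by (simp add: prime_dvd_fact_iff)
      ultimately have "\<not> p dvd u choose r"
        using dvd_trans by blast
      then show ?thesis
        using True by simp
    qed (simp add: binomial_eq_0)
    have "\<not> int p dvd fps_nth F n \<longleftrightarrow> \<not> int p dvd
        fps_nth F (n div p) * (int (u choose (n mod p)) * (- a) ^ (n mod p))"
      using cong_dvd_iff[OF root_coefficient_cong[OF assms(1-4), of n]] by simp
    also have "\<dots> \<longleftrightarrow> \<not> int p dvd fps_nth F (n div p) \<and> n mod p \<le> u"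
      using a prime_dvd_power[OF prime, of "- a" "n mod p"]
      unfolding prime_dvd_mult_iff[OF prime] choose by auto
    also have "\<dots> \<longleftrightarrow> (\<forall>i. base_digit p n i \<le> u)"
    proof -
      have "n div p < n"
        using False prime_gt_1_nat[OF assms(1)] by simp
      then show ?thesis
        by (subst all_base_digit_iff) (auto simp only: less)
    qed
    finally show ?thesis .
  qed
qed

theorem theorem3p6:
  fixes k p n :: nat and u :: int
  assumes "k > 0"
    and "prime p"
    and "int p = int k * u + 1"
  shows "\<exists>m::int. c n k = of_int m \<and>
    (\<not> int p dvd m \<longleftrightarrow>
      (\<forall>i. (of_nat (base_digit p n i) :: rat) < of_nat p / of_nat k))"
proof -
  obtain F :: "int fps" where F: "\<And>n. c n k = of_int (fps_nth F n)"
    "F ^ k * (1 - fps_const (int k ^ 2) * fps_X) = 1" "fps_nth F 0 = 1"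
    using integral_root_exists[OF assms(1)] by blast
  \<comment> \<open>Since \<open>p > 1\<close>, the integer \<open>u\<close> is positive and can be
    replaced by a natural number.\<close>
  have "int k * u > 0"
    using assms(3) prime_gt_1_nat[OF assms(2)] by linarith
  then have "u > 0"
    using assms(1) by (simp add: zero_less_mult_iff)
  then obtain v where v: "u = int v"
    using zero_less_imp_eq_int by blast
  then have p: "p = k * v + 1"
    using assms(3) by (simp flip: of_nat_mult)
  have "\<not> p dvd k"
  proof
    assume "p dvd k"
    then have "p dvd k * v"
      by simp
    moreover have "p dvd k * v + 1"
      by (simp only: p[symmetric] dvd_refl)
    ultimately have "p dvd 1"
      by (simp only: dvd_add_right_iff)
    then show False
      using assms(2) by simp
  qed
  then have "\<not> int p dvd int k ^ 2"
    using assms(2) by (simp add: prime_dvd_power_iff)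
  then have iff: "\<not> int p dvd fps_nth F n \<longleftrightarrow> (\<forall>i. base_digit p n i \<le> v)"
    using not_dvd_root_coefficient_iff[OF assms(2) p assms(1) F(2,3)] by blast
  \<comment> \<open>Here \<open>p / k = v + 1 / k\<close>, and clearing denominators turns the
    strict bound into \<open>d k < k v + 1\<close>.\<close>
  have "(of_nat d :: rat) < of_nat p / of_nat k \<longleftrightarrow> d \<le> v" for d
  proof -
    have "(of_nat d :: rat) < of_nat p / of_nat k \<longleftrightarrow> of_nat (d * k) < (of_nat p :: rat)"
      using assms(1) by (simp add: field_simps)
    also have "\<dots> \<longleftrightarrow> d * k \<le> v * k"
      unfolding p of_nat_less_iff mult.commute[of k v] by linarith
    finally show ?thesis
      using assms(1) by simp
  qed
  then show ?thesis
    by (intro exI[of _ "fps_nth F n"]) (simp only: F(1) iff)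
qed

end
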